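(* Let $X\in\mathbb{R}^{n\times p}$ have columns in general position, $y\in\mathbb{R}^n$, $\lambda_{\mathrm L}>0$, let $E$ and $s$ be the Lasso equicorrelation set and equicorrelation sign vector, let $q\ge0$ be an integer and $A\in\mathbb{R}^{q\times|E|}$. Let $\hat\delta_A$ and $\hat\beta_A=\hat\beta_{\mathrm L}+\hat\delta_A$ be the generalized correction and the generalized Lasso--Ridge estimator associated with $A$. Then the coordinates of the correction indexed by $E$ satisfy $$(\Sigma_{n,E}+A^\top A)\hat\delta_{A,E}=\lambda_{\mathrm L}s .$$ Consequently, $$\hat\delta_{A,E}=(\Sigma_{n,E}+A^\top A)^{-1}\lambda_{\mathrm L}s,\qquad \hat\delta_{A,-E}=0,$$ and $$\hat\beta_{A,E}=\hat\beta_{\mathrm L,E}+(\Sigma_{n,E}+A^\top A)^{-1}\lambda_{\mathrm L}s,\qquad \hat\beta_{A,-E}=0 .$$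
   Context: Notation: $X_S$ is the submatrix of columns of $X$ indexed by $S\subseteq\{1,\dots,p\}$; $v_S$, $v_{-S}$ are the subvectors of $v$ indexed by $S$ and its complement. Zero-dimensional vectors and matrices are allowed, and the $0\times0$ matrix is invertible with itself as inverse. General position: for every integer $0\le k<\min\{n,p\}$, no $k$-dimensional affine subspace of $\mathbb{R}^n$ contains more than $k+1$ elements of $\{\pm X_1,\dots,\pm X_p\}$, excluding antipodal pairs (i.e. for any distinct indices $i_1,\dots,i_{k+2}$ and any signs $\sigma_1,\dots,\sigma_{k+2}\in\{\pm1\}$, the vectors $\sigma_1X_{i_1},\dots,\sigma_{k+2}X_{i_{k+2}}$ do not all lie in a $k$-dimensional affine subspace). Under general position the Lasso minimizer below is unique and $X_E$ has full column rank. Lasso: $\hat\beta_{\mathrm L}=\arg\min_{\beta\in\mathbb{R}^p}\{\frac1{2n}\|y-X\beta\|_2^2+\lambda_{\mathrm L}\|\beta\|_1\}$. Equicorrelation set: $E=\{j:|\frac1nX_j^\top(y-X\hat\beta_{\mathrm L})|=\lambda_{\mathrm L}\}$. Sign vector: $s=\operatorname{sign}(X_E^\top(y-X\hat\beta_{\mathrm L}))\in\{-1,1\}^{|E|}$. Restricted Gram matrix: $\Sigma_{n,E}=\frac1nX_E^\top X_E$. Generalized Lasso--Ridge estimator: $\hat\beta_A=\hat\beta_{\mathrm L}+\hat\delta_A$, where $\hat\delta_A$ is a minimizer over $\delta\in\mathbb{R}^p$ with $\delta_{-E}=0$ of $\frac1{2n}\|y-X\hat\beta_{\mathrm L}-X\delta\|_2^2+\frac12\|A\delta_E\|_2^2$.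 *)

theory Defs
  imports
    Complex_Main
    "Jordan_Normal_Form.VS_Connect"
    "Jordan_Normal_Form.DL_Submatrix"
    "Jordan_Normal_Form.Gauss_Jordan_Elimination"
begin

text \<open>
  The number of rows and columns is read off the design matrix \<open>X\<close> (\<open>n = dim_row X\<close>,
  \<open>p = dim_col X\<close>), and coordinates are numbered from \<open>0\<close>.
\<close>

text \<open>\<open>subvec v S\<close> is the vector analogue of \<open>submatrix\<close>: coordinates indexed by \<open>S\<close>, in
  increasing order.  Elements of \<open>S\<close> beyond the dimension are ignored, so that \<open>subvec v (- S)\<close> is
  the subvector of the complementary coordinates.\<close>

definition subvec :: "'a vec \<Rightarrow> nat set \<Rightarrow> 'a vec" where
  "subvec v S = vec (card {i. i < dim_vec v \<and> i \<in> S}) (\<lambda>i. v $ pick S i)"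

abbreviation subcols :: "'a mat \<Rightarrow> nat set \<Rightarrow> 'a mat" where
  "subcols X S \<equiv> submatrix X UNIV S"

definition sq_l2_norm :: "real vec \<Rightarrow> real" where
  "sq_l2_norm v = v \<bullet> v"

definition l1_norm :: "real vec \<Rightarrow> real" where
  "l1_norm v = (\<Sum>i<dim_vec v. \<bar>v $ i\<bar>)"

text \<open>Only meaningful for \<open>invertible_mat M\<close>.\<close>

definition mat_inv :: "real mat \<Rightarrow> real mat" where
  "mat_inv M = the (mat_inverse M)"

definition affine_subspace :: "nat \<Rightarrow> nat \<Rightarrow> real vec set \<Rightarrow> bool" where
  "affine_subspace n k V \<longleftrightarrow>
     (\<exists>a\<in>carrier_vec n. \<exists>W.
        VectorSpace.subspace class_ring W (module_vec TYPE(real) n) \<and>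
        vectorspace.dim class_ring ((module_vec TYPE(real) n)\<lparr>carrier := W\<rparr>) = k \<and>
        V = (\<lambda>w. a + w) ` W)"

text \<open>The columns are counted by index: a choice of \<open>k + 2\<close> distinct columns, each with one sign,
  is what remains of \<open>k + 2\<close> elements of \<open>{\<plusminus>X\<^sub>1, \<dots>, \<plusminus>X\<^sub>p}\<close> once antipodal
  pairs are excluded.  In particular repeated columns violate the condition (when \<open>k = 0\<close> is
  admitted).\<close>

definition general_position :: "real mat \<Rightarrow> bool" where
  "general_position X \<longleftrightarrow>
     (\<forall>k < min (dim_row X) (dim_col X). \<forall>(ind :: nat \<Rightarrow> nat) (\<sigma> :: nat \<Rightarrow> real).
        inj_on ind {..<k + 2} \<and> ind ` {..<k + 2} \<subseteq> {..<dim_col X} \<and> \<sigma> ` {..<k + 2} \<subseteq> {-1, 1} \<longrightarrow>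
        \<not> (\<exists>V. affine_subspace (dim_row X) k V \<and>
               (\<forall>l<k + 2. \<sigma> l \<cdot>\<^sub>v col X (ind l) \<in> V)))"

definition lasso_objective :: "real mat \<Rightarrow> real vec \<Rightarrow> real \<Rightarrow> real vec \<Rightarrow> real" where
  "lasso_objective X y lam b =
     1 / (2 * real (dim_row X)) * sq_l2_norm (y - X *\<^sub>v b) + lam * l1_norm b"

definition is_lasso :: "real mat \<Rightarrow> real vec \<Rightarrow> real \<Rightarrow> real vec \<Rightarrow> bool" where
  "is_lasso X y lam b \<longleftrightarrow>
     is_arg_min (lasso_objective X y lam) (\<lambda>b. b \<in> carrier_vec (dim_col X)) b"

definition equicorrelation_set :: "real mat \<Rightarrow> real vec \<Rightarrow> real \<Rightarrow> real vec \<Rightarrow> nat set" where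
  "equicorrelation_set X y lam bL =
     {j. j < dim_col X \<and> \<bar>1 / real (dim_row X) * (col X j \<bullet> (y - X *\<^sub>v bL))\<bar> = lam}"

definition equicorrelation_signs :: "real mat \<Rightarrow> real vec \<Rightarrow> nat set \<Rightarrow> real vec \<Rightarrow> real vec" where
  "equicorrelation_signs X y E bL =
     map_vec sgn (transpose_mat (subcols X E) *\<^sub>v (y - X *\<^sub>v bL))"

definition restricted_gram :: "real mat \<Rightarrow> nat set \<Rightarrow> real mat" where
  "restricted_gram X E = (1 / real (dim_row X)) \<cdot>\<^sub>m (transpose_mat (subcols X E) * subcols X E)"

definition correction_objective ::
  "real mat \<Rightarrow> real vec \<Rightarrow> nat set \<Rightarrow> real vec \<Rightarrow> real mat \<Rightarrow> real vec \<Rightarrow> real" where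
  "correction_objective X y E bL A d =
     1 / (2 * real (dim_row X)) * sq_l2_norm (y - X *\<^sub>v bL - X *\<^sub>v d)
       + 1 / 2 * sq_l2_norm (A *\<^sub>v subvec d E)"

definition is_generalized_correction ::
  "real mat \<Rightarrow> real vec \<Rightarrow> nat set \<Rightarrow> real vec \<Rightarrow> real mat \<Rightarrow> real vec \<Rightarrow> bool" where
  "is_generalized_correction X y E bL A d \<longleftrightarrow>
     is_arg_min (correction_objective X y E bL A)
       (\<lambda>d. d \<in> carrier_vec (dim_col X) \<and> subvec d (- E) = 0\<^sub>v (dim_col X - card E)) d"

end

(*
  At a Lasso minimizer the inner product of the residual with every equicorrelated column is
  plus or minus n lamL, so the columns of E, each multiplied by its sign, lie in an affine
  hyperplane missing the origin.  A minimal linear dependence among k + 2 of them is therefore an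
  affine one: it puts k + 2 signed columns in an affine subspace of dimension k, against general
  position.  Hence X_E has trivial kernel and the regularized Gram matrix is positive definite.
  The equation for the correction is the vanishing of the directional derivative of its quadratic
  objective; the Lasso optimality conditions make the Lasso solution vanish off E.
*)
theory Submission
  imports Defs "Jordan_Normal_Form.DL_Rank"
begin

section \<open>Subvectors and column submatrices indexed by a set\<close>

lemma bij_betw_pick:
  assumes "finite S"
  shows "bij_betw (pick S) {..<card S} S"
proof (rule bij_betw_imageI)
  show "inj_on (pick S) {..<card S}"
    by (rule linorder_inj_onI) (use pick_mono_le[of _ S] in fastforce)+
  moreover have "pick S ` {..<card S} \<subseteq> S"
    using pick_in_set_le by blast
  ultimately show "pick S ` {..<card S} = S"
    using assms by (intro card_subset_eq) (simp_all add: card_image)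
qed

lemma sum_pick:
  assumes "finite S"
  shows "(\<Sum>i<card S. f (pick S i)) = (\<Sum>j\<in>S. f j)"
  using sum.reindex_bij_betw[OF bij_betw_pick[OF assms]] .

lemma card_restrict: "S \<subseteq> {..<m} \<Longrightarrow> card {i. i < m \<and> i \<in> S} = card S" for m :: nat
  by (rule arg_cong[of _ _ card]) auto

lemma card_restrict_Compl: "S \<subseteq> {..<m} \<Longrightarrow> card {i. i < m \<and> i \<in> - S} = m - card S" for m :: nat
proof -
  assume S: "S \<subseteq> {..<m}"
  have "{i. i < m \<and> i \<in> - S} = {..<m} - S" by auto
  then show ?thesis using S by (simp add: card_Diff_subset finite_subset)
qed

lemma pick_lt: "S \<subseteq> {..<m} \<Longrightarrow> i < card S \<Longrightarrow> pick S i < m"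
  using pick_in_set_le by blast

lemma subvec_add:
  assumes "v \<in> carrier_vec m" "w \<in> carrier_vec m"
  shows "subvec (v + w) S = subvec v S + subvec w S"
  using assms by (intro eq_vecI) (auto simp: subvec_def pick_le)

text \<open>Every \<open>j\<close> in \<open>S\<close> is reached by \<open>pick S\<close>, namely
  from the number of smaller elements of \<open>S\<close>. The set is left arbitrary because
  complements \<open>- S\<close>, which are infinite, have to be covered.\<close>

lemma subvec_eq_iff:
  assumes "v \<in> carrier_vec m" "w \<in> carrier_vec m"
  shows "subvec v S = subvec w S \<longleftrightarrow> (\<forall>j<m. j \<in> S \<longrightarrow> v $ j = w $ j)"
proof
  assume eq: "subvec v S = subvec w S"
  show "\<forall>j<m. j \<in> S \<longrightarrow> v $ j = w $ j"
  proof (intro allI impI)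
    fix j assume j: "j < m" "j \<in> S"
    have "{a \<in> S. a < j} \<subset> {i. i < m \<and> i \<in> S}" using j by auto
    then have "card {a \<in> S. a < j} < card {i. i < m \<and> i \<in> S}"
      by (simp add: psubset_card_mono)
    then have "v $ pick S (card {a \<in> S. a < j}) = w $ pick S (card {a \<in> S. a < j})"
      using arg_cong[OF eq, of "\<lambda>u. u $ card {a \<in> S. a < j}"] assms by (simp add: subvec_def)
    then show "v $ j = w $ j" using pick_card_in_set[OF j(2)] by simp
  qed
next
  assume eq: "\<forall>j<m. j \<in> S \<longrightarrow> v $ j = w $ j"
  have "pick S i < m \<and> pick S i \<in> S" if "i < card {i. i < m \<and> i \<in> S}" for i
    using that pick_le[OF that] pick_reduce_set[OF that] pick_in_set_le[OF that] by simp
  then show "subvec v S = subvec w S"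
    using assms eq by (intro eq_vecI) (auto simp: subvec_def)
qed

lemma subvec_zero: "subvec (0\<^sub>v m :: 'a::zero vec) S = 0\<^sub>v (card {i. i < m \<and> i \<in> S})"
  by (intro eq_vecI) (auto simp: subvec_def pick_le)

lemma subvec_Compl_eq_zero_iff:
  fixes v :: "'a::zero vec"
  assumes "v \<in> carrier_vec m" "S \<subseteq> {..<m}"
  shows "subvec v (- S) = 0\<^sub>v (m - card S) \<longleftrightarrow> (\<forall>j<m. j \<notin> S \<longrightarrow> v $ j = 0)"
  using subvec_eq_iff[OF assms(1) zero_carrier_vec, of "- S"] assms(2)
  by (simp add: subvec_zero card_restrict_Compl flip: Compl_iff)

text \<open>A right inverse of taking the \<open>S\<close>-coordinates:
  \<open>card {a \<in> S. a < j}\<close> is the rank of \<open>j\<close> in \<open>S\<close>, which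
  undoes \<open>pick S\<close>. It turns any vector of length \<open>card E\<close> into an
  admissible competitor for the correction.\<close>

definition extend_vec :: "nat \<Rightarrow> nat set \<Rightarrow> 'a::zero vec \<Rightarrow> 'a vec" where
  "extend_vec m S z = vec m (\<lambda>j. if j \<in> S then z $ card {a \<in> S. a < j} else 0)"

lemma extend_vec_carrier [simp]: "extend_vec m S z \<in> carrier_vec m"
  by (simp add: extend_vec_def)

lemma subvec_extend_vec:
  assumes "S \<subseteq> {..<m}" "z \<in> carrier_vec (card S)"
  shows "subvec (extend_vec m S z) S = z"
proof (rule eq_vecI)
  fix i assume "i < dim_vec z"
  then have i: "i < card S" using assms by simp
  have "pick S i < m" "pick S i \<in> S" using pick_lt[OF assms(1) i] pick_in_set_le[OF i] by auto
  then show "subvec (extend_vec m S z) S $ i = z $ i"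
    using i by (simp add: subvec_def extend_vec_def card_restrict[OF assms(1)] card_pick_le)
qed (use assms in \<open>simp add: subvec_def extend_vec_def card_restrict[OF assms(1)]\<close>)

lemma subvec_Compl_extend_vec:
  "S \<subseteq> {..<m} \<Longrightarrow> subvec (extend_vec m S z) (- S) = 0\<^sub>v (m - card S)"
  by (simp add: subvec_Compl_eq_zero_iff) (simp add: extend_vec_def)

lemma subcols_carrier:
  assumes "X \<in> carrier_mat n p" "S \<subseteq> {..<p}"
  shows "subcols X S \<in> carrier_mat n (card S)"
  using assms by (auto simp: submatrix_def card_restrict)

lemma index_subcols:
  assumes "X \<in> carrier_mat n p" "S \<subseteq> {..<p}" "i < n" "j < card S"
  shows "subcols X S $$ (i, j) = X $$ (i, pick S j)"
  using assms by (simp add: submatrix_def card_restrict pick_UNIV)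

lemma col_subcols:
  assumes "X \<in> carrier_mat n p" "S \<subseteq> {..<p}" "j < card S"
  shows "col (subcols X S) j = col X (pick S j)"
  using assms subcols_carrier[OF assms(1,2)] pick_lt[OF assms(2,3)]
  by (intro eq_vecI) (auto simp: index_subcols)

text \<open>The columns outside \<open>S\<close> meet only zero entries of \<open>d\<close>. This
  replaces the constrained problem in \<open>p\<close> coordinates by a free one in
  \<open>card S\<close> coordinates.\<close>

lemma mult_mat_vec_subcols:
  fixes X :: "'a::semiring_0 mat"
  assumes X: "X \<in> carrier_mat n p" and S: "S \<subseteq> {..<p}"
    and d: "d \<in> carrier_vec p" and z: "subvec d (- S) = 0\<^sub>v (p - card S)"
  shows "X *\<^sub>v d = subcols X S *\<^sub>v subvec d S"
proof (rule eq_vecI)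
  have c: "subcols X S \<in> carrier_mat n (card S)" by (rule subcols_carrier[OF X S])
  then show "dim_vec (X *\<^sub>v d) = dim_vec (subcols X S *\<^sub>v subvec d S)" using X by simp
  fix i assume "i < dim_vec (subcols X S *\<^sub>v subvec d S)"
  then have i: "i < n" using c by simp
  have fin: "finite S" using S finite_subset by blast
  have "(subcols X S *\<^sub>v subvec d S) $ i = (\<Sum>j<card S. X $$ (i, pick S j) * d $ pick S j)"
    using i c d by (auto simp: scalar_prod_def subvec_def card_restrict[OF S] lessThan_atLeast0
      index_subcols[OF X S] intro!: sum.cong)
  also have "\<dots> = (\<Sum>j\<in>S. X $$ (i, j) * d $ j)"
    by (rule sum_pick[OF fin])
  also have "\<dots> = (\<Sum>j<p. X $$ (i, j) * d $ j)"
    using S z d by (intro sum.mono_neutral_left) (auto simp: subvec_Compl_eq_zero_iff)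
  also have "\<dots> = (X *\<^sub>v d) $ i"
    using i X d by (auto simp: scalar_prod_def lessThan_atLeast0 intro!: sum.cong)
  finally show "(X *\<^sub>v d) $ i = (subcols X S *\<^sub>v subvec d S) $ i" ..
qed

lemma mult_mat_unit_vec:
  fixes A :: "'a::semiring_1 mat"
  assumes "A \<in> carrier_mat n m" "j < m"
  shows "A *\<^sub>v unit_vec m j = col A j"
  using assms by (intro eq_vecI) auto

section \<open>Quadratic objectives and normal equations\<close>

text \<open>A first-order condition without derivatives: for small \<open>t\<close> of sign opposite
  to \<open>a\<close> the linear term outweighs the quadratic one. The range is limited by
  \<open>\<epsilon>\<close> because the Lasso objective is quadratic along a coordinate only until
  that coordinate changes sign.\<close>

lemma linear_coeff_zero_of_nonneg:
  fixes a b \<epsilon> :: real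
  assumes "\<epsilon> > 0" and nonneg: "\<And>t. \<bar>t\<bar> \<le> \<epsilon> \<Longrightarrow> 0 \<le> a * t + b * t\<^sup>2"
  shows "a = 0"
proof (rule ccontr)
  assume "a \<noteq> 0"
  \<comment> \<open>Small enough that \<open>\<bar>b\<bar> * t\<close> is at most half of
    \<open>\<bar>a\<bar>\<close>; the added 1 keeps the denominator positive.\<close>
  define t where "t = min \<epsilon> (\<bar>a\<bar> / (2 * (\<bar>b\<bar> + 1)))"
  have t: "t > 0" "t \<le> \<epsilon>" using \<open>a \<noteq> 0\<close> assms(1) by (auto simp: t_def)
  have "0 \<le> a * (- sgn a * t) + b * (- sgn a * t)\<^sup>2"
    by (rule nonneg) (use t \<open>a \<noteq> 0\<close> in \<open>auto simp: abs_mult abs_sgn_eq\<close>)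
  also have "\<dots> = t * (b * t - \<bar>a\<bar>)"
    using \<open>a \<noteq> 0\<close> by (simp add: sgn_if power2_eq_square algebra_simps)
  finally have "\<bar>a\<bar> \<le> b * t" using t by (simp add: zero_le_mult_iff)
  also have "\<dots> \<le> (\<bar>b\<bar> + 1) * t" using t by (intro mult_right_mono) auto
  also have "\<dots> \<le> (\<bar>b\<bar> + 1) * (\<bar>a\<bar> / (2 * (\<bar>b\<bar> + 1)))"
    by (intro mult_left_mono) (auto simp: t_def)
  also have "\<dots> = \<bar>a\<bar> / 2" by (simp add: field_simps)
  finally show False using \<open>a \<noteq> 0\<close> by simp
qed

lemma sq_l2_norm_diff_smult:
  assumes "w \<in> carrier_vec m" "v \<in> carrier_vec m"
  shows "sq_l2_norm (w - t \<cdot>\<^sub>v v) = sq_l2_norm w - 2 * t * (w \<bullet> v) + t\<^sup>2 * sq_l2_norm v"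
proof -
  have "(w - t \<cdot>\<^sub>v v) \<bullet> (w - t \<cdot>\<^sub>v v) = (\<Sum>i<m. w $ i * w $ i - 2 * t * (w $ i * v $ i) + t\<^sup>2 * (v $ i * v $ i))"
    using assms by (auto simp: scalar_prod_def lessThan_atLeast0 power2_eq_square algebra_simps
        intro!: sum.cong)
  also have "\<dots> = w \<bullet> w - 2 * t * (w \<bullet> v) + t\<^sup>2 * (v \<bullet> v)"
    using assms by (simp add: scalar_prod_def lessThan_atLeast0 sum.distrib sum_subtractf
        sum_distrib_left)
  finally show ?thesis by (simp add: sq_l2_norm_def)
qed

lemma sq_l2_norm_nonneg: "0 \<le> sq_l2_norm v"
  by (simp add: sq_l2_norm_def scalar_prod_def sum_nonneg)

lemma sq_l2_norm_eq_0:
  assumes "sq_l2_norm v = 0" "v \<in> carrier_vec m"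
  shows "v = 0\<^sub>v m"
  using assms by (intro eq_vecI) (auto simp: sq_l2_norm_def scalar_prod_def sum_nonneg_eq_0_iff)

lemma gram_sum_mult_vec:
  fixes A B :: "'a::comm_ring_1 mat"
  assumes B: "B \<in> carrier_mat n m" and A: "A \<in> carrier_mat q m" and z: "z \<in> carrier_vec m"
  shows "(c \<cdot>\<^sub>m (B\<^sup>T * B) + A\<^sup>T * A) *\<^sub>v z = c \<cdot>\<^sub>v (B\<^sup>T *\<^sub>v (B *\<^sub>v z)) + A\<^sup>T *\<^sub>v (A *\<^sub>v z)"
proof -
  have BB: "B\<^sup>T * B \<in> carrier_mat m m" and AA: "A\<^sup>T * A \<in> carrier_mat m m"
    using A B by auto
  have "(c \<cdot>\<^sub>m (B\<^sup>T * B) + A\<^sup>T * A) *\<^sub>v z = c \<cdot>\<^sub>m (B\<^sup>T * B) *\<^sub>v z + A\<^sup>T * A *\<^sub>v z"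
    by (rule add_mult_distrib_mat_vec) (use BB AA z in auto)
  also have "c \<cdot>\<^sub>m (B\<^sup>T * B) *\<^sub>v z = c \<cdot>\<^sub>v (B\<^sup>T * B *\<^sub>v z)"
    using BB z by (intro eq_vecI) auto
  also have "B\<^sup>T * B *\<^sub>v z = B\<^sup>T *\<^sub>v (B *\<^sub>v z)"
    by (rule assoc_mult_mat_vec[of _ m n _ m]) (use B z in auto)
  also have "A\<^sup>T * A *\<^sub>v z = A\<^sup>T *\<^sub>v (A *\<^sub>v z)"
    by (rule assoc_mult_mat_vec[of _ m q _ m]) (use A z in auto)
  finally show ?thesis .
qed

text \<open>The vector \<open>g\<close> of the proof is the negative gradient of the objective at
  \<open>z\<close>. Moving from \<open>z\<close> by \<open>t\<close> times \<open>g\<close> changes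
  the objective by \<open>- (g \<bullet> g) * t\<close> plus a multiple of the square of
  \<open>t\<close>, so minimality forces \<open>g\<close> to vanish, which rearranges to the
  claim.\<close>

lemma regularized_normal_equations:
  fixes c :: real
  assumes B: "B \<in> carrier_mat n m" and A: "A \<in> carrier_mat q m"
    and r: "r \<in> carrier_vec n" and z: "z \<in> carrier_vec m"
    and min: "\<And>x. x \<in> carrier_vec m \<Longrightarrow>
      c / 2 * sq_l2_norm (r - B *\<^sub>v z) + 1 / 2 * sq_l2_norm (A *\<^sub>v z)
      \<le> c / 2 * sq_l2_norm (r - B *\<^sub>v x) + 1 / 2 * sq_l2_norm (A *\<^sub>v x)"
  shows "(c \<cdot>\<^sub>m (B\<^sup>T * B) + A\<^sup>T * A) *\<^sub>v z = c \<cdot>\<^sub>v (B\<^sup>T *\<^sub>v r)"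
proof -
  let ?w = "r - B *\<^sub>v z"
  define g where "g = c \<cdot>\<^sub>v (B\<^sup>T *\<^sub>v ?w) - A\<^sup>T *\<^sub>v (A *\<^sub>v z)"
  have w: "?w \<in> carrier_vec n" using r B z by simp
  have Bw: "B\<^sup>T *\<^sub>v ?w \<in> carrier_vec m" and Bz: "B\<^sup>T *\<^sub>v (B *\<^sub>v z) \<in> carrier_vec m"
    and Br: "B\<^sup>T *\<^sub>v r \<in> carrier_vec m" and Az: "A\<^sup>T *\<^sub>v (A *\<^sub>v z) \<in> carrier_vec m"
    using A B w r z by simp_all
  have g: "g \<in> carrier_vec m" unfolding g_def using Bw Az by simp
  have gg: "g \<bullet> g = c * (?w \<bullet> (B *\<^sub>v g)) - (A *\<^sub>v z) \<bullet> (A *\<^sub>v g)"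
  proof -
    have "(c \<cdot>\<^sub>v (B\<^sup>T *\<^sub>v ?w) - A\<^sup>T *\<^sub>v (A *\<^sub>v z)) \<bullet> g
        = c * ((B\<^sup>T *\<^sub>v ?w) \<bullet> g) - (A\<^sup>T *\<^sub>v (A *\<^sub>v z)) \<bullet> g"
      using Bw Az g by (subst minus_scalar_prod_distrib[of _ m]) auto
    also have "(B\<^sup>T *\<^sub>v ?w) \<bullet> g = ?w \<bullet> (B *\<^sub>v g)"
      by (rule transpose_vec_mult_scalar[OF B g w])
    also have "(A\<^sup>T *\<^sub>v (A *\<^sub>v z)) \<bullet> g = (A *\<^sub>v z) \<bullet> (A *\<^sub>v g)"
      using A z by (intro transpose_vec_mult_scalar[OF A g]) simp
    finally show ?thesis by (simp flip: g_def)
  qed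
  let ?Q = "c / 2 * sq_l2_norm (B *\<^sub>v g) + 1 / 2 * sq_l2_norm (A *\<^sub>v g)"
  have "- (g \<bullet> g) = 0"
  proof (rule linear_coeff_zero_of_nonneg[of 1 _ ?Q])
    fix t :: real
    have zt: "z + t \<cdot>\<^sub>v g \<in> carrier_vec m" using z g by simp
    have "r - B *\<^sub>v (z + t \<cdot>\<^sub>v g) = ?w - t \<cdot>\<^sub>v (B *\<^sub>v g)"
      using B r z g by (auto simp: mult_add_distrib_mat_vec[OF B] mult_mat_vec[OF B])
    then have 1: "sq_l2_norm (r - B *\<^sub>v (z + t \<cdot>\<^sub>v g))
        = sq_l2_norm ?w - 2 * t * (?w \<bullet> (B *\<^sub>v g)) + t\<^sup>2 * sq_l2_norm (B *\<^sub>v g)"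
      using B g w by (simp add: sq_l2_norm_diff_smult[of _ n])
    have "A *\<^sub>v (z + t \<cdot>\<^sub>v g) = A *\<^sub>v z - (- t) \<cdot>\<^sub>v (A *\<^sub>v g)"
      using A z g by (auto simp: mult_add_distrib_mat_vec[OF A] mult_mat_vec[OF A])
    then have 2: "sq_l2_norm (A *\<^sub>v (z + t \<cdot>\<^sub>v g))
        = sq_l2_norm (A *\<^sub>v z) - 2 * (- t) * ((A *\<^sub>v z) \<bullet> (A *\<^sub>v g)) + (- t)\<^sup>2 * sq_l2_norm (A *\<^sub>v g)"
      using A g z by (simp only: sq_l2_norm_diff_smult[of _ q] mult_mat_vec_carrier)
    show "0 \<le> - (g \<bullet> g) * t + ?Q * t\<^sup>2"
      using min[OF zt] unfolding 1 2 gg by (simp add: algebra_simps)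
  qed simp
  then have "g = 0\<^sub>v m"
    using sq_l2_norm_eq_0[OF _ g] by (simp add: sq_l2_norm_def)
  have "B\<^sup>T *\<^sub>v ?w = B\<^sup>T *\<^sub>v r - B\<^sup>T *\<^sub>v (B *\<^sub>v z)"
    using B r z by (intro mult_minus_distrib_mat_vec[of _ m n]) auto
  then have g': "g = c \<cdot>\<^sub>v (B\<^sup>T *\<^sub>v r - B\<^sup>T *\<^sub>v (B *\<^sub>v z)) - A\<^sup>T *\<^sub>v (A *\<^sub>v z)"
    by (simp add: g_def)
  have "(c \<cdot>\<^sub>m (B\<^sup>T * B) + A\<^sup>T * A) *\<^sub>v z = c \<cdot>\<^sub>v (B\<^sup>T *\<^sub>v (B *\<^sub>v z)) + A\<^sup>T *\<^sub>v (A *\<^sub>v z)"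
    by (rule gram_sum_mult_vec[OF B A z])
  also have "\<dots> = c \<cdot>\<^sub>v (B\<^sup>T *\<^sub>v r) - g"
  proof -
    have "c \<cdot>\<^sub>v u + w = c \<cdot>\<^sub>v v - (c \<cdot>\<^sub>v (v - u) - w)"
      if "u \<in> carrier_vec m" "v \<in> carrier_vec m" "w \<in> carrier_vec m" for u v w
      using that by (intro eq_vecI) (auto simp: algebra_simps)
    from this[OF Bz Br Az] show ?thesis unfolding g' .
  qed
  also have "\<dots> = c \<cdot>\<^sub>v (B\<^sup>T *\<^sub>v r)" using B r \<open>g = 0\<^sub>v m\<close> by auto
  finally show ?thesis .
qed

section \<open>Affine subspaces and general position\<close>

text \<open>A trivial kernel makes the columns of \<open>B\<close> distinct and linearly
  independent, so their span, which is the image of \<open>B\<close>, has dimension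
  \<open>k\<close>.\<close>

lemma affine_subspace_translate_col_space:
  fixes B :: "real mat"
  assumes B: "B \<in> carrier_mat n k" and a: "a \<in> carrier_vec n"
    and ker: "\<And>v. v \<in> carrier_vec k \<Longrightarrow> B *\<^sub>v v = 0\<^sub>v n \<Longrightarrow> v = 0\<^sub>v k"
  shows "affine_subspace n k ((\<lambda>v. a + B *\<^sub>v v) ` carrier_vec k)" "k \<le> n"
proof -
  interpret vec_space "TYPE(real)" n .
  \<comment> \<open>Linear independence refers to the set of columns, so repetitions are excluded
    first: two equal columns would put a difference of unit vectors into the kernel.\<close>
  have dist: "distinct (cols B)"
  proof (rule ccontr)
    assume "\<not> distinct (cols B)"
    then obtain i j where ij: "i < k" "j < k" "i \<noteq> j" "col B i = col B j"
      using B by (auto simp: distinct_conv_nth)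
    have "B *\<^sub>v (unit_vec k i - unit_vec k j) = B *\<^sub>v unit_vec k i - B *\<^sub>v unit_vec k j"
      by (rule mult_minus_distrib_mat_vec[OF B]) simp_all
    also have "\<dots> = col B j - col B j"
      by (simp only: mult_mat_unit_vec[OF B] ij)
    also have "\<dots> = 0\<^sub>v n" using B ij(2) by (intro minus_cancel_vec col_carrier_vec)
    finally have "unit_vec k i - unit_vec k j = (0\<^sub>v k :: real vec)"
      by (intro ker) auto
    then have "(unit_vec k i - unit_vec k j) $ i = (0\<^sub>v k :: real vec) $ i" by (rule arg_cong)
    then show False using ij(1-3) by simp
  qed
  have indpt: "lin_indpt (set (cols B))"
    by (rule notI, rule lin_depE[OF B _ dist]) (use ker in auto)
  have rank: "rank B = k" by (rule lin_indpt_full_rank[OF B dist indpt])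
  have sub: "set (cols B) \<subseteq> carrier_vec n" using B cols_dim by blast
  have "card (set (cols B)) \<le> dim"
    by (rule li_le_dim(2)[OF fin_dim _ indpt]) (use sub in auto)
  then show "k \<le> n"
    using B dist by (simp add: distinct_card dim_is_n)
  have span: "span (set (cols B)) = (\<lambda>v. B *\<^sub>v v) ` carrier_vec k"
    using col_space_eq[OF B] B by (auto simp: col_space_def)
  have "VectorSpace.subspace class_ring (span (set (cols B))) V"
    by (rule span_is_subspace) (simp add: sub)
  moreover have "vectorspace.dim class_ring (V\<lparr>carrier := span (set (cols B))\<rparr>) = k"
    using rank by (simp add: rank_def)
  moreover have "(\<lambda>v. a + B *\<^sub>v v) ` carrier_vec k = (\<lambda>w. a + w) ` span (set (cols B))"
    by (simp add: span image_image)
  ultimately show "affine_subspace n k ((\<lambda>v. a + B *\<^sub>v v) ` carrier_vec k)"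
    using a unfolding affine_subspace_def by blast
qed

lemma dim_le_of_trivial_kernel:
  fixes B :: "real mat"
  assumes "B \<in> carrier_mat n k"
    and "\<And>v. v \<in> carrier_vec k \<Longrightarrow> B *\<^sub>v v = 0\<^sub>v n \<Longrightarrow> v = 0\<^sub>v k"
  shows "k \<le> n"
  using affine_subspace_translate_col_space(2)[OF assms(1) zero_carrier_vec assms(2)] .

text \<open>Since \<open>u 0\<close> to \<open>u k\<close> are linearly independent, their
  \<open>k\<close> differences from \<open>u 0\<close> span a space of dimension \<open>k\<close>;
  the affine relation, solved for its last vector, places \<open>u (k + 1)\<close> in the same
  translate.\<close>

lemma affine_subspace_of_affine_dependence:
  fixes u :: "nat \<Rightarrow> real vec" and b :: "nat \<Rightarrow> real"
  assumes u: "\<And>l. l < k + 2 \<Longrightarrow> u l \<in> carrier_vec n"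
    and indep: "\<And>a. (\<And>i. i < n \<Longrightarrow> (\<Sum>l<k+1. a l * u l $ i) = 0) \<Longrightarrow> (\<And>l. l < k + 1 \<Longrightarrow> a l = 0)"
    and dep: "\<And>i. i < n \<Longrightarrow> (\<Sum>l<k+2. b l * u l $ i) = 0"
    and aff: "(\<Sum>l<k+2. b l) = 0" and last: "b (k + 1) \<noteq> 0"
  shows "k < n" "\<exists>V. affine_subspace n k V \<and> (\<forall>l<k+2. u l \<in> V)"
proof -
  have "k + 1 \<le> n"
  proof (rule dim_le_of_trivial_kernel)
    show "mat n (k+1) (\<lambda>(i, l). u l $ i) \<in> carrier_mat n (k+1)" by simp
    fix v :: "real vec" assume v: "v \<in> carrier_vec (k+1)" "mat n (k+1) (\<lambda>(i, l). u l $ i) *\<^sub>v v = 0\<^sub>v n"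
    have sum_zero: "(\<Sum>l<k+1. v $ l * u l $ i) = 0" if "i < n" for i
    proof -
      have "(mat n (k+1) (\<lambda>(i, l). u l $ i) *\<^sub>v v) $ i = (\<Sum>l<k+1. v $ l * u l $ i)"
        using that v(1) by (auto simp: scalar_prod_def lessThan_atLeast0 mult.commute simp del: sum.op_ivl_Suc intro!: sum.cong)
      then show ?thesis using that by (simp only: v(2) index_zero_vec)
    qed
    have "v $ l = 0" if "l < k + 1" for l
      by (rule indep[of "\<lambda>l. v $ l", OF sum_zero that])
    then show "v = 0\<^sub>v (k+1)" using v(1) by (intro eq_vecI) auto
  qed
  then show "k < n" by simp
  define B where "B = mat n k (\<lambda>(i, l). u (Suc l) $ i - u 0 $ i)"
  have B: "B \<in> carrier_mat n k" by (simp add: B_def)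
  have B_index: "(B *\<^sub>v v) $ i = (\<Sum>l<k. v $ l * (u (Suc l) $ i - u 0 $ i))"
    if "v \<in> carrier_vec k" "i < n" for v i
    using that by (auto simp: B_def scalar_prod_def lessThan_atLeast0 mult.commute intro!: sum.cong)
  have aff_sub: "affine_subspace n k ((\<lambda>v. u 0 + B *\<^sub>v v) ` carrier_vec k)"
  proof (rule affine_subspace_translate_col_space(1)[OF B])
    show "u 0 \<in> carrier_vec n" by (rule u) simp
    fix v assume v: "v \<in> carrier_vec k" "B *\<^sub>v v = 0\<^sub>v n"
    \<comment> \<open>A relation between the differences becomes one between the vectors themselves
      once \<open>u 0\<close> receives minus the sum of the coefficients.\<close>
    define a where "a = (\<lambda>l. case l of 0 \<Rightarrow> - (\<Sum>l<k. v $ l) | Suc l \<Rightarrow> v $ l)"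
    have sum_zero: "(\<Sum>l<k+1. a l * u l $ i) = 0" if "i < n" for i
    proof -
      have "(\<Sum>l<k+1. a l * u l $ i) = (B *\<^sub>v v) $ i"
        using that v(1) unfolding Suc_eq_plus1[symmetric]
        by (simp add: B_index sum.lessThan_Suc_shift a_def right_diff_distrib sum_subtractf
            sum_distrib_right del: sum.lessThan_Suc)
      then show ?thesis using v(2) that by simp
    qed
    have "a (Suc l) = 0" if "l < k" for l
      by (rule indep[of a, OF sum_zero]) (use that in simp_all)
    then have "v $ l = 0" if "l < k" for l using that by (simp add: a_def)
    then show "v = 0\<^sub>v k" using v(1) by (intro eq_vecI) auto
  qed
  have "u l \<in> (\<lambda>v. u 0 + B *\<^sub>v v) ` carrier_vec k" if l: "l < k + 2" for l
  proof -
    \<comment> \<open>It remains to write \<open>u l - u 0\<close> as a combination of the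
      differences: trivially for \<open>l = 0\<close>, by a unit vector for the next
      \<open>k\<close> indices, and by the affine relation for \<open>l = k + 1\<close>.\<close>
    have mem: "u l \<in> (\<lambda>v. u 0 + B *\<^sub>v v) ` carrier_vec k"
      if v: "v \<in> carrier_vec k"
        and eq: "\<And>i. i < n \<Longrightarrow> (\<Sum>l<k. v $ l * (u (Suc l) $ i - u 0 $ i)) = u l $ i - u 0 $ i" for v
    proof (rule image_eqI[OF _ v], rule eq_vecI)
      show "dim_vec (u l) = dim_vec (u 0 + B *\<^sub>v v)" using u[OF l] B by simp
      show "u l $ i = (u 0 + B *\<^sub>v v) $ i" if "i < dim_vec (u 0 + B *\<^sub>v v)" for i
        using that B u[of 0] eq[of i] B_index[OF v, of i] by simp
    qed
    consider "l = 0" | l' where "l = Suc l'" "l' < k" | "l = k + 1"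
      using l by (cases l) (auto simp: less_Suc_eq)
    then show ?thesis
    proof cases
      case 1
      show ?thesis by (rule mem[of "0\<^sub>v k"]) (simp_all add: 1)
    next
      case (2 l')
      show ?thesis
      proof (rule mem[of "unit_vec k l'"])
        fix i
        have "(\<Sum>l<k. unit_vec k l' $ l * (u (Suc l) $ i - u 0 $ i))
            = (\<Sum>l<k. if l = l' then u (Suc l) $ i - u 0 $ i else 0)"
          by (intro sum.cong) (use 2 in auto)
        then show "(\<Sum>l<k. unit_vec k l' $ l * (u (Suc l) $ i - u 0 $ i)) = u l $ i - u 0 $ i"
          using 2 by simp
      qed simp
    next
      case 3
      \<comment> \<open>As the \<open>b l\<close> sum to zero, the relation also holds between the
        \<open>u l - u 0\<close>. Its term for \<open>l = 0\<close> vanishes, and dividing by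
        \<open>b (k + 1)\<close> gives these coefficients.\<close>
      define w where "w = vec k (\<lambda>l. - b (Suc l) / b (k + 1))"
      show ?thesis
      proof (rule mem[of w])
        fix i assume i: "i < n"
        have "0 = (\<Sum>l<k+2. b l * u l $ i) - (\<Sum>l<k+2. b l) * u 0 $ i"
          using dep[OF i] aff by simp
        also have "\<dots> = (\<Sum>l<k+2. b l * (u l $ i - u 0 $ i))"
          by (simp add: right_diff_distrib sum_subtractf sum_distrib_right del: sum.lessThan_Suc)
        also have "\<dots> = (\<Sum>l<Suc k. b (Suc l) * (u (Suc l) $ i - u 0 $ i))"
          by (simp add: sum.lessThan_Suc_shift[of _ "Suc k"] numeral_2_eq_2 del: sum.lessThan_Suc)
        also have "\<dots> = (\<Sum>l<k. b (Suc l) * (u (Suc l) $ i - u 0 $ i)) + b (k+1) * (u l $ i - u 0 $ i)"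
          using 3 by simp
        finally have "(\<Sum>l<k. b (Suc l) * (u (Suc l) $ i - u 0 $ i)) = - b (k+1) * (u l $ i - u 0 $ i)"
          by simp
        then have "- (\<Sum>l<k. b (Suc l) * (u (Suc l) $ i - u 0 $ i)) / b (k + 1) = u l $ i - u 0 $ i"
          using last by (simp add: field_simps)
        moreover have "(\<Sum>l<k. w $ l * (u (Suc l) $ i - u 0 $ i))
            = - (\<Sum>l<k. b (Suc l) * (u (Suc l) $ i - u 0 $ i)) / b (k + 1)"
          by (simp add: w_def sum_divide_distrib flip: sum_negf)
        ultimately show "(\<Sum>l<k. w $ l * (u (Suc l) $ i - u 0 $ i)) = u l $ i - u 0 $ i" by simp
      qed (simp add: w_def)
    qed
  qed
  then show "\<exists>V. affine_subspace n k V \<and> (\<forall>l<k+2. u l \<in> V)"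
    using aff_sub by blast
qed

lemma mult_mat_vec_eq_zero_iff:
  assumes "X \<in> carrier_mat n p" "d \<in> carrier_vec p"
  shows "X *\<^sub>v d = 0\<^sub>v n \<longleftrightarrow> (\<forall>i<n. (\<Sum>j<p. d $ j * X $$ (i, j)) = (0 :: 'a :: comm_semiring_0))"
proof -
  have "(X *\<^sub>v d) $ i = (\<Sum>j<p. d $ j * X $$ (i, j))" if "i < n" for i
    using that assms by (auto simp: scalar_prod_def lessThan_atLeast0 mult.commute intro!: sum.cong)
  moreover have "dim_vec (X *\<^sub>v d) = n" using assms by simp
  ultimately show ?thesis by (auto simp: vec_eq_iff)
qed

text \<open>Each signed column has inner product \<open>c\<close> with \<open>r\<close>, so the
  coefficients of a linear relation between signed columns sum to zero. A kernel vector of smallest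
  support supplies such a relation together with the independence of all but one of its
  columns.\<close>

lemma general_position_trivial_kernel:
  fixes X :: "real mat"
  assumes gp: "general_position X" and X: "X \<in> carrier_mat n p" and r: "r \<in> carrier_vec n"
    and E: "E \<subseteq> {..<p}" and c: "c > 0" and equi: "\<And>j. j \<in> E \<Longrightarrow> \<bar>col X j \<bullet> r\<bar> = c"
    and d: "d \<in> carrier_vec p" "\<And>j. j < p \<Longrightarrow> j \<notin> E \<Longrightarrow> d $ j = 0" "X *\<^sub>v d = 0\<^sub>v n"
  shows "d = 0\<^sub>v p"
proof (rule ccontr)
  assume "d \<noteq> 0\<^sub>v p"
  define supp where "supp = (\<lambda>d :: real vec. {j. j < p \<and> d $ j \<noteq> 0})"
  \<comment> \<open>The nonzero kernel vectors supported in \<open>E\<close>. One of smallest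
    support is a minimal dependence.\<close>
  define K where "K = (\<lambda>d. d \<in> carrier_vec p \<and> d \<noteq> 0\<^sub>v p \<and> supp d \<subseteq> E \<and> X *\<^sub>v d = 0\<^sub>v n)"
  have "K d" using d \<open>d \<noteq> 0\<^sub>v p\<close> by (auto simp: K_def supp_def)
  then obtain e where e: "K e" and e_min: "\<And>e'. K e' \<Longrightarrow> card (supp e) \<le> card (supp e')"
    using ex_has_least_nat[of K d "\<lambda>e. card (supp e)"] by blast
  have ec: "e \<in> carrier_vec p" and eE: "supp e \<subseteq> E" and Xe: "X *\<^sub>v e = 0\<^sub>v n"
    using e by (auto simp: K_def)
  have fin: "finite (supp e)" and sp: "supp e \<subseteq> {..<p}" by (auto simp: supp_def)
  have sum_supp: "(\<Sum>j<p. e $ j * f j) = (\<Sum>j\<in>supp e. e $ j * f j)" for f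
    by (intro sum.mono_neutral_right) (auto simp: supp_def)
  have Xe_r: "(\<Sum>j\<in>supp e. e $ j * (col X j \<bullet> r)) = 0"
  proof -
    have "(\<Sum>j\<in>supp e. e $ j * (col X j \<bullet> r)) = (\<Sum>j<p. e $ j * (col X j \<bullet> r))"
      by (rule sum_supp[symmetric])
    also have "\<dots> = (\<Sum>j<p. \<Sum>i<n. e $ j * X $$ (i, j) * r $ i)"
      using X r by (intro sum.cong) (auto simp: scalar_prod_def lessThan_atLeast0 sum_distrib_left
          mult.assoc intro!: sum.cong)
    also have "\<dots> = (\<Sum>i<n. (\<Sum>j<p. e $ j * X $$ (i, j)) * r $ i)"
      by (subst sum.swap) (simp add: sum_distrib_right)
    also have "\<dots> = 0"
      using Xe mult_mat_vec_eq_zero_iff[OF X ec] by simp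
    finally show ?thesis .
  qed
  have "supp e \<noteq> {}"
  proof
    assume "supp e = {}"
    then have "e = 0\<^sub>v p" using ec by (intro eq_vecI) (auto simp: supp_def)
    then show False using e by (simp add: K_def)
  qed
  \<comment> \<open>A relation with a single column would make that column orthogonal to
    \<open>r\<close>, against \<open>c > 0\<close>. The support size can then be written
    \<open>k + 2\<close>, the count used in \<open>general_position\<close>.\<close>
  moreover have "card (supp e) \<noteq> 1"
  proof
    assume "card (supp e) = 1"
    then obtain j where j: "supp e = {j}" by (auto simp: card_1_singleton_iff)
    then have "e $ j \<noteq> 0" "j \<in> E" using eE by (auto simp: supp_def)
    then show False using Xe_r equi[of j] c by (simp add: j)
  qed
  ultimately have "card (supp e) \<ge> 2"
    using fin by (metis One_nat_def card_0_eq less_2_cases not_le)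
  then obtain k where k: "card (supp e) = k + 2" by (metis add.commute le_Suc_ex)
  obtain ind where ind: "bij_betw ind {..<k + 2} (supp e)"
    using ex_bij_betw_nat_finite[OF fin] by (auto simp: k lessThan_atLeast0)
  have ind_mem: "ind l \<in> supp e" if "l < k + 2" for l using bij_betwE[OF ind] that by auto
  have ind_p: "ind l < p" if "l < k + 2" for l using ind_mem[OF that] sp by auto
  have ind_inj: "inj_on ind {..<k + 2}" using ind by (rule bij_betw_imp_inj_on)
  \<comment> \<open>The sign that makes the inner product of the signed column with \<open>r\<close>
    equal to \<open>c\<close>.\<close>
  define \<sigma> where "\<sigma> = (\<lambda>l. sgn (col X (ind l) \<bullet> r))"
  have \<sigma>_r: "\<sigma> l * c = col X (ind l) \<bullet> r" if "l < k + 2" for l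
  proof -
    have "\<bar>col X (ind l) \<bullet> r\<bar> = c" using equi ind_mem[OF that] eE by blast
    then show ?thesis using sgn_mult_abs[of "col X (ind l) \<bullet> r"] by (simp add: \<sigma>_def)
  qed
  have \<sigma>_pm: "\<sigma> l \<in> {-1, 1}" if "l < k + 2" for l
    using equi[of "ind l"] ind_mem[OF that] eE c by (auto simp: \<sigma>_def sgn_if)
  then have \<sigma>_sq: "\<sigma> l * \<sigma> l = 1" if "l < k + 2" for l using that by fastforce
  define u where "u = (\<lambda>l. \<sigma> l \<cdot>\<^sub>v col X (ind l))"
  have u_index: "u l $ i = \<sigma> l * X $$ (i, ind l)" if "l < k + 2" "i < n" for l i
    using that ind_p[OF that(1)] X by (simp add: u_def)
  have indep: "a l = 0"
    if a: "\<And>i. i < n \<Longrightarrow> (\<Sum>l<k+1. a l * u l $ i) = 0" and l: "l < k + 1" for a :: "nat \<Rightarrow> real" and l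
  proof (rule ccontr)
    assume "a l \<noteq> 0"
    let ?inv = "the_inv_into {..<k + 2} ind"
    have inv: "?inv (ind l) = l" if "l < k + 2" for l
      using the_inv_into_f_f[OF ind_inj] that by simp
    \<comment> \<open>The relation between the first \<open>k + 1\<close> signed columns, read as a
      kernel vector of \<open>X\<close>: the factor \<open>\<sigma>\<close> moves the signs into the
      coefficients. Its support misses \<open>ind (k + 1)\<close>, against minimality.\<close>
    define e' where "e' = vec p (\<lambda>j. if j \<in> ind ` {..<k+1} then a (?inv j) * \<sigma> (?inv j) else 0)"
    have e'_ind: "e' $ ind l = a l * \<sigma> l" if "l < k + 1" for l
      using that inv[of l] ind_p[of l] by (simp add: e'_def)
    have supp_e': "supp e' \<subseteq> ind ` {..<k+1}" by (auto simp: supp_def e'_def split: if_splits)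
    then have "supp e' \<subseteq> supp e" using ind_mem by fastforce
    have card: "card (supp e') < card (supp e)"
    proof -
      have "card (supp e') \<le> card (ind ` {..<k+1})" by (rule card_mono[OF _ supp_e']) simp
      also have "\<dots> \<le> k + 1" using card_image_le[of "{..<k+1}" ind] by simp
      finally show ?thesis using k by simp
    qed
    have "(\<Sum>j<p. e' $ j * X $$ (i, j)) = 0" if i: "i < n" for i
    proof -
      have "(\<Sum>j<p. e' $ j * X $$ (i, j)) = (\<Sum>j\<in>ind ` {..<k+1}. e' $ j * X $$ (i, j))"
        by (intro sum.mono_neutral_right) (auto simp: ind_p e'_def)
      also have "\<dots> = (\<Sum>l<k+1. e' $ ind l * X $$ (i, ind l))"
        by (subst sum.reindex) (auto intro: inj_on_subset[OF ind_inj])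
      also have "\<dots> = (\<Sum>l<k+1. a l * u l $ i)"
        by (intro sum.cong) (use i in \<open>auto simp: e'_ind u_index\<close>)
      finally show ?thesis using a[OF i] by simp
    qed
    moreover have e'c: "e' \<in> carrier_vec p" by (simp add: e'_def)
    ultimately have "X *\<^sub>v e' = 0\<^sub>v n" using mult_mat_vec_eq_zero_iff[OF X] by blast
    moreover have "e' $ ind l \<noteq> 0" "ind l < p"
      using e'_ind[OF l] \<open>a l \<noteq> 0\<close> \<sigma>_pm[of l] ind_p[of l] l by auto
    then have "e' \<noteq> 0\<^sub>v p" by auto
    ultimately have "K e'"
      using e'c \<open>supp e' \<subseteq> supp e\<close> eE by (auto simp: K_def)
    then show False using e_min card by fastforce
  qed
  have reindex: "(\<Sum>l<k+2. f (ind l)) = (\<Sum>j\<in>supp e. f j)" for f :: "nat \<Rightarrow> real"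
    by (rule sum.reindex_bij_betw[OF ind])
  \<comment> \<open>Because \<open>\<sigma> l * \<sigma> l = 1\<close>, these are the coefficients
    of the relation given by \<open>e\<close> with respect to the signed columns.\<close>
  define b where "b = (\<lambda>l. e $ ind l * \<sigma> l)"
  have dep: "(\<Sum>l<k+2. b l * u l $ i) = 0" if i: "i < n" for i
  proof -
    have "(\<Sum>l<k+2. b l * u l $ i) = (\<Sum>l<k+2. e $ ind l * X $$ (i, ind l))"
    proof (rule sum.cong[OF refl])
      fix l assume "l \<in> {..<k+2}"
      then have l: "l < k + 2" by simp
      have "b l * u l $ i = e $ ind l * X $$ (i, ind l) * (\<sigma> l * \<sigma> l)"
        by (simp add: b_def u_index[OF l i])
      then show "b l * u l $ i = e $ ind l * X $$ (i, ind l)" by (simp add: \<sigma>_sq[OF l])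
    qed
    also have "\<dots> = (\<Sum>j<p. e $ j * X $$ (i, j))"
      unfolding reindex[of "\<lambda>j. e $ j * X $$ (i, j)"] sum_supp ..
    finally show ?thesis using Xe mult_mat_vec_eq_zero_iff[OF X ec] i by simp
  qed
  \<comment> \<open>Pairing the relation with \<open>r\<close> yields \<open>c\<close> times the
    coefficient sum, so that sum vanishes and the relation is affine.\<close>
  have "(\<Sum>l<k+2. b l) * c = (\<Sum>l<k+2. e $ ind l * (col X (ind l) \<bullet> r))"
    unfolding sum_distrib_right by (intro sum.cong) (auto simp: b_def \<sigma>_r mult.assoc)
  also have "\<dots> = 0" unfolding reindex[of "\<lambda>j. e $ j * (col X j \<bullet> r)"] by (rule Xe_r)
  finally have aff: "(\<Sum>l<k+2. b l) = 0" using c by simp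
  have last: "b (k + 1) \<noteq> 0"
    using ind_mem[of "k + 1"] \<sigma>_pm[of "k + 1"] by (auto simp: b_def supp_def)
  have uc: "u l \<in> carrier_vec n" if "l < k + 2" for l
    using X by (auto simp: u_def)
  have kn: "k < n"
    by (rule affine_subspace_of_affine_dependence(1)[of k u n b]) (fact uc indep dep aff last)+
  have V: "\<exists>V. affine_subspace n k V \<and> (\<forall>l<k+2. u l \<in> V)"
    by (rule affine_subspace_of_affine_dependence(2)[of k u n b]) (fact uc indep dep aff last)+
  \<comment> \<open>General position speaks only of \<open>k\<close> below both dimensions:
    \<open>k < n\<close> comes from independence, \<open>k < p\<close> from the size of the
    support.\<close>
  have "k + 2 \<le> p" using card_mono[OF _ sp] k by simp
  then have kmin: "k < min (dim_row X) (dim_col X)" using kn X by simp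
  have "inj_on ind {..<k + 2} \<and> ind ` {..<k + 2} \<subseteq> {..<dim_col X} \<and> \<sigma> ` {..<k + 2} \<subseteq> {-1, 1}"
    using ind_inj ind_p \<sigma>_pm X by blast
  moreover have "\<exists>V. affine_subspace (dim_row X) k V \<and> (\<forall>l<k + 2. \<sigma> l \<cdot>\<^sub>v col X (ind l) \<in> V)"
    using V X by (simp add: u_def)
  ultimately show False
    using gp kmin unfolding general_position_def by blast
qed

section \<open>Optimality conditions for the Lasso\<close>

lemma l1_norm_add_unit:
  assumes "b \<in> carrier_vec p" "j < p"
  shows "l1_norm (b + t \<cdot>\<^sub>v unit_vec p j) = l1_norm b + (\<bar>b $ j + t\<bar> - \<bar>b $ j\<bar>)"
proof -
  have "l1_norm (b + t \<cdot>\<^sub>v unit_vec p j) = (\<Sum>i<p. \<bar>b $ i\<bar> + (if i = j then \<bar>b $ j + t\<bar> - \<bar>b $ j\<bar> else 0))"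
    unfolding l1_norm_def by (rule sum.cong) (use assms in auto)
  then show ?thesis using assms by (simp add: l1_norm_def sum.distrib)
qed

text \<open>For steps of size at most \<open>\<bar>b $ j\<bar>\<close> the coordinate
  \<open>j\<close> does not change sign, so the penalty is linear in the step and the objective is a
  quadratic polynomial in it, whose linear coefficient vanishes at the minimizer.\<close>

lemma is_lasso_stationary:
  assumes X: "X \<in> carrier_mat n p" and y: "y \<in> carrier_vec n"
    and lasso: "is_lasso X y lam b" and j: "j < p" "b $ j \<noteq> 0"
  shows "1 / real n * (col X j \<bullet> (y - X *\<^sub>v b)) = lam * sgn (b $ j)"
proof -
  have b: "b \<in> carrier_vec p"
    and min: "\<And>x. x \<in> carrier_vec p \<Longrightarrow> lasso_objective X y lam b \<le> lasso_objective X y lam x"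
    using lasso X by (auto simp: is_lasso_def is_arg_min_linorder)
  let ?r = "y - X *\<^sub>v b" and ?x = "col X j"
  have "lam * sgn (b $ j) - 1 / real n * (?r \<bullet> ?x) = 0"
  proof (rule linear_coeff_zero_of_nonneg[of "\<bar>b $ j\<bar>" _ "1 / (2 * real n) * sq_l2_norm ?x"])
    fix t :: real assume t: "\<bar>t\<bar> \<le> \<bar>b $ j\<bar>"
    have "X *\<^sub>v (b + t \<cdot>\<^sub>v unit_vec p j) = X *\<^sub>v b + t \<cdot>\<^sub>v ?x"
      using X b j by (simp add: mult_add_distrib_mat_vec[OF X] mult_mat_vec[OF X] mult_mat_unit_vec)
    then have "y - X *\<^sub>v (b + t \<cdot>\<^sub>v unit_vec p j) = ?r - t \<cdot>\<^sub>v ?x"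
      using X y b by (intro eq_vecI) auto
    then have sq: "sq_l2_norm (y - X *\<^sub>v (b + t \<cdot>\<^sub>v unit_vec p j))
        = sq_l2_norm ?r - 2 * t * (?r \<bullet> ?x) + t\<^sup>2 * sq_l2_norm ?x"
      using X y b j by (simp add: sq_l2_norm_diff_smult[of _ n])
    have "\<bar>b $ j + t\<bar> - \<bar>b $ j\<bar> = t * sgn (b $ j)"
      using t j by (auto simp: sgn_if abs_if split: if_splits)
    then have l1: "l1_norm (b + t \<cdot>\<^sub>v unit_vec p j) = l1_norm b + t * sgn (b $ j)"
      using l1_norm_add_unit[OF b j(1)] by simp
    have "b + t \<cdot>\<^sub>v unit_vec p j \<in> carrier_vec p" using b by simp
    from min[OF this] show "0 \<le> (lam * sgn (b $ j) - 1 / real n * (?r \<bullet> ?x)) * t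
        + 1 / (2 * real n) * sq_l2_norm ?x * t\<^sup>2"
      unfolding lasso_objective_def sq l1 using X
      by (simp add: algebra_simps add_divide_distrib diff_divide_distrib)
  qed (use j in simp)
  then show ?thesis
    using X y b j(1) comm_scalar_prod[of ?r n ?x] by simp
qed

text \<open>By stationarity, the normalized correlation at a nonzero coordinate has absolute value
  \<open>lam\<close>, which is membership in the equicorrelation set.\<close>

lemma is_lasso_zero_outside_equicorrelation_set:
  assumes "X \<in> carrier_mat n p" "y \<in> carrier_vec n" "lam > 0" "is_lasso X y lam b"
    and "j < p" "j \<notin> equicorrelation_set X y lam b"
  shows "b $ j = 0"
proof (rule ccontr)
  assume "b $ j \<noteq> 0"
  then have "\<bar>1 / real n * (col X j \<bullet> (y - X *\<^sub>v b))\<bar> = lam"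
    using assms(3) is_lasso_stationary[OF assms(1,2,4,5)]
    by (simp only: abs_mult[of lam] abs_sgn_eq not_False_eq_True if_False)
  then show False using assms by (simp add: equicorrelation_set_def)
qed

section \<open>Invertibility and the formula for the correction\<close>

text \<open>A trivial kernel gives a nonzero determinant, hence a unit of the matrix ring, so
  \<open>mat_inverse\<close> cannot return \<open>None\<close>. This gives \<open>mat_inv\<close>
  its meaning.\<close>

lemma mat_inverse_of_trivial_kernel:
  fixes M :: "'a::field mat"
  assumes M: "M \<in> carrier_mat m m"
    and ker: "\<And>v. v \<in> carrier_vec m \<Longrightarrow> M *\<^sub>v v = 0\<^sub>v m \<Longrightarrow> v = 0\<^sub>v m"
  obtains B where "mat_inverse M = Some B" "B \<in> carrier_mat m m" "M * B = 1\<^sub>m m" "B * M = 1\<^sub>m m"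
proof -
  have "det M \<noteq> 0" using det_0_iff_vec_prod_zero[OF M] ker by blast
  then have "M \<in> Units (ring_mat TYPE('a) m ())" by (rule det_non_zero_imp_unit[OF M])
  then obtain B where "mat_inverse M = Some B"
    using mat_inverse(1)[OF M] by fastforce
  then show ?thesis using that mat_inverse(2)[OF M] by blast
qed

theorem proposition3p2:
  fixes n p q :: nat
    and X A :: "real mat"
    and y s \<beta>L \<delta>A \<beta>A :: "real vec"
    and lamL :: real
    and E :: "nat set"
  assumes "n \<ge> 1"
    and "X \<in> carrier_mat n p"
    and "general_position X"
    and "y \<in> carrier_vec n"
    and "lamL > 0"
    and "is_lasso X y lamL \<beta>L"
    and "E = equicorrelation_set X y lamL \<beta>L"
    and "s = equicorrelation_signs X y E \<beta>L"
    and "A \<in> carrier_mat q (card E)"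
    and "is_generalized_correction X y E \<beta>L A \<delta>A"
    and "\<beta>A = \<beta>L + \<delta>A"
  shows
    "((restricted_gram X E + transpose_mat A * A) *\<^sub>v subvec \<delta>A E = lamL \<cdot>\<^sub>v s) \<and>
     invertible_mat (restricted_gram X E + transpose_mat A * A) \<and>
     (subvec \<delta>A E = mat_inv (restricted_gram X E + transpose_mat A * A) *\<^sub>v (lamL \<cdot>\<^sub>v s)) \<and>
     (subvec \<delta>A (- E) = 0\<^sub>v (p - card E)) \<and>
     (subvec \<beta>A E
         = subvec \<beta>L E + mat_inv (restricted_gram X E + transpose_mat A * A) *\<^sub>v (lamL \<cdot>\<^sub>v s)) \<and>
     (subvec \<beta>A (- E) = 0\<^sub>v (p - card E))"
proof -
  note X = assms(2) and y = assms(4) and lam = assms(5) and A = assms(9)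
  have n: "n > 0" using assms(1) by linarith
  have L: "\<beta>L \<in> carrier_vec p"
    using assms(6) unfolding is_lasso_def is_arg_min_linorder carrier_matD(2)[OF X] by (rule conjunct1)
  let ?r = "y - X *\<^sub>v \<beta>L" and ?B = "subcols X E"
  have r: "?r \<in> carrier_vec n"
    by (intro minus_carrier_vec y mult_mat_vec_carrier[OF X L])
  have E: "E \<subseteq> {..<p}" using X by (auto simp: assms(7) equicorrelation_set_def)
  have B: "?B \<in> carrier_mat n (card E)" by (rule subcols_carrier[OF X E])
  \<comment> \<open>With the factor \<open>1 / real n\<close> cleared, \<open>real n * lamL\<close>
    serves as the constant \<open>c\<close> of the kernel lemma.\<close>
  have equi: "\<bar>col X j \<bullet> ?r\<bar> = real n * lamL" if "j \<in> E" for j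
  proof -
    have "\<bar>1 / real n * (col X j \<bullet> ?r)\<bar> = lamL"
      using that X unfolding assms(7) equicorrelation_set_def by simp
    then show ?thesis using n by (simp add: abs_mult nonzero_divide_eq_eq mult.commute)
  qed
  have corr: "(\<delta>A \<in> carrier_vec p \<and> subvec \<delta>A (- E) = 0\<^sub>v (p - card E)) \<and>
      (\<forall>x. x \<in> carrier_vec p \<and> subvec x (- E) = 0\<^sub>v (p - card E) \<longrightarrow>
        correction_objective X y E \<beta>L A \<delta>A \<le> correction_objective X y E \<beta>L A x)"
    using assms(10) unfolding is_generalized_correction_def is_arg_min_linorder carrier_matD(2)[OF X] .
  then have d: "\<delta>A \<in> carrier_vec p" and dE: "subvec \<delta>A (- E) = 0\<^sub>v (p - card E)"
    by blast+
  let ?z = "subvec \<delta>A E" and ?M = "restricted_gram X E + A\<^sup>T * A"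
  have z: "?z \<in> carrier_vec (card E)"
    using carrier_vecD[OF d] by (intro carrier_vecI) (simp only: subvec_def dim_vec card_restrict[OF E])
  have M: "?M \<in> carrier_mat (card E) (card E)"
    using A B by (simp add: restricted_gram_def)
  have M_eq: "?M = 1 / real n \<cdot>\<^sub>m (?B\<^sup>T * ?B) + A\<^sup>T * A"
    using X by (simp add: restricted_gram_def)
  \<comment> \<open>On \<open>E\<close> the correlations have absolute value \<open>lamL\<close> and
    \<open>s\<close> records their signs, which identifies the right-hand side of the normal
    equations.\<close>
  have Bs: "1 / real n \<cdot>\<^sub>v (?B\<^sup>T *\<^sub>v ?r) = lamL \<cdot>\<^sub>v s"
  proof (rule eq_vecI)
    have s_dim: "dim_vec s = card E" and B_dim: "dim_vec (?B\<^sup>T *\<^sub>v ?r) = card E"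
      unfolding assms(8) equicorrelation_signs_def using carrier_matD(2)[OF B] by simp_all
    then show "dim_vec (1 / real n \<cdot>\<^sub>v (?B\<^sup>T *\<^sub>v ?r)) = dim_vec (lamL \<cdot>\<^sub>v s)"
      by (simp only: index_smult_vec)
    fix i assume "i < dim_vec (lamL \<cdot>\<^sub>v s)"
    then have i: "i < card E" by (simp only: index_smult_vec s_dim)
    let ?x = "col X (pick E i) \<bullet> ?r"
    have Br: "(?B\<^sup>T *\<^sub>v ?r) $ i = ?x"
      using i B by (simp only: index_mult_mat_vec index_transpose_mat carrier_matD row_transpose
          col_subcols[OF X E])
    then have "s $ i = sgn ?x"
      unfolding assms(8) equicorrelation_signs_def
      using i B_dim by (simp only: index_map_vec)
    moreover have "1 / real n * ?x = lamL * sgn ?x"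
    proof -
      have "1 / real n * ?x = 1 / real n * (sgn ?x * \<bar>?x\<bar>)" by (simp only: sgn_mult_abs)
      also have "\<dots> = lamL * sgn ?x"
        unfolding equi[OF pick_in_set_le[OF i]] using n by simp
      finally show ?thesis .
    qed
    ultimately show "(1 / real n \<cdot>\<^sub>v (?B\<^sup>T *\<^sub>v ?r)) $ i = (lamL \<cdot>\<^sub>v s) $ i"
      using i by (simp only: index_smult_vec B_dim s_dim Br)
  qed
  have normal: "?M *\<^sub>v ?z = lamL \<cdot>\<^sub>v s"
  proof -
    have "?M *\<^sub>v ?z = 1 / real n \<cdot>\<^sub>v (?B\<^sup>T *\<^sub>v ?r)"
      unfolding M_eq
    proof (rule regularized_normal_equations[OF B A r z])
      fix x :: "real vec" assume x: "x \<in> carrier_vec (card E)"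
      \<comment> \<open>Padding with zeros makes \<open>x\<close> an admissible correction, so
        constrained minimality yields minimality over all vectors of length
        \<open>card E\<close>.\<close>
      let ?x = "extend_vec p E x"
      note ext = subvec_Compl_extend_vec[OF E, of x] subvec_extend_vec[OF E x]
      have d_min: "correction_objective X y E \<beta>L A \<delta>A \<le> correction_objective X y E \<beta>L A ?x"
        using corr extend_vec_carrier ext(1) by blast
      have "X *\<^sub>v ?x = ?B *\<^sub>v x"
        using mult_mat_vec_subcols[OF X E _ ext(1)] ext(2) by simp
      then show "1 / real n / 2 * sq_l2_norm (?r - ?B *\<^sub>v ?z) + 1 / 2 * sq_l2_norm (A *\<^sub>v ?z)
        \<le> 1 / real n / 2 * sq_l2_norm (?r - ?B *\<^sub>v x) + 1 / 2 * sq_l2_norm (A *\<^sub>v x)"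
        using d_min mult_mat_vec_subcols[OF X E d dE] ext(2) X
        by (simp add: correction_objective_def mult.commute)
    qed
    then show ?thesis by (simp only: Bs)
  qed
  have ker: "v = 0\<^sub>v (card E)" if v: "v \<in> carrier_vec (card E)" and Mv: "?M *\<^sub>v v = 0\<^sub>v (card E)" for v
  proof -
    have Bv: "?B *\<^sub>v v \<in> carrier_vec n" and Av: "A *\<^sub>v v \<in> carrier_vec q" using B A v by auto
    have BBv: "?B\<^sup>T *\<^sub>v (?B *\<^sub>v v) \<in> carrier_vec (card E)"
      and AAv: "A\<^sup>T *\<^sub>v (A *\<^sub>v v) \<in> carrier_vec (card E)"
      using B A Bv Av by simp_all
    have nonneg: "0 \<le> 1 / real n * sq_l2_norm (?B *\<^sub>v v)"
      by (simp add: sq_l2_norm_nonneg)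
    \<comment> \<open>The quadratic form of \<open>?M\<close> at \<open>v\<close> is a sum of two
      nonnegative squared norms, so the one coming from \<open>?B\<close> vanishes.\<close>
    have "0 = v \<bullet> (?M *\<^sub>v v)" using v by (simp add: Mv)
    also have "\<dots> = v \<bullet> (1 / real n \<cdot>\<^sub>v (?B\<^sup>T *\<^sub>v (?B *\<^sub>v v)) + A\<^sup>T *\<^sub>v (A *\<^sub>v v))"
      unfolding M_eq gram_sum_mult_vec[OF B A v] ..
    also have "\<dots> = 1 / real n * (v \<bullet> (?B\<^sup>T *\<^sub>v (?B *\<^sub>v v))) + v \<bullet> (A\<^sup>T *\<^sub>v (A *\<^sub>v v))"
      using v BBv AAv by (simp add: scalar_prod_add_distrib[of _ "card E"])
    also have "v \<bullet> (?B\<^sup>T *\<^sub>v (?B *\<^sub>v v)) = sq_l2_norm (?B *\<^sub>v v)"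
      unfolding sq_l2_norm_def transpose_vec_mult_scalar[OF B v Bv, symmetric]
      by (rule comm_scalar_prod[OF v BBv])
    also have "v \<bullet> (A\<^sup>T *\<^sub>v (A *\<^sub>v v)) = sq_l2_norm (A *\<^sub>v v)"
      unfolding sq_l2_norm_def transpose_vec_mult_scalar[OF A v Av, symmetric]
      by (rule comm_scalar_prod[OF v AAv])
    finally have "1 / real n * sq_l2_norm (?B *\<^sub>v v) = 0"
      using sq_l2_norm_nonneg[of "A *\<^sub>v v"] nonneg by linarith
    then have "?B *\<^sub>v v = 0\<^sub>v n" using n sq_l2_norm_eq_0[OF _ Bv] by simp
    \<comment> \<open>Padded with zeros, \<open>v\<close> is a kernel vector of \<open>X\<close>
      supported in \<open>E\<close>, and general position forces it to be zero.\<close>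
    then have "X *\<^sub>v extend_vec p E v = 0\<^sub>v n"
      using mult_mat_vec_subcols[OF X E _ subvec_Compl_extend_vec[OF E]] subvec_extend_vec[OF E v]
      by simp
    then have "extend_vec p E v = 0\<^sub>v p"
      using general_position_trivial_kernel[OF assms(3) X r E _ equi extend_vec_carrier] n lam
      by (simp add: extend_vec_def)
    then have "v = subvec (0\<^sub>v p) E" using subvec_extend_vec[OF E v] by simp
    then show ?thesis by (simp add: subvec_zero card_restrict[OF E])
  qed
  obtain N where N: "mat_inverse ?M = Some N" "N \<in> carrier_mat (card E) (card E)"
    "?M * N = 1\<^sub>m (card E)" "N * ?M = 1\<^sub>m (card E)"
    by (rule mat_inverse_of_trivial_kernel[OF M ker])
  have inv: "invertible_mat ?M"
    using N carrier_matD[OF M] carrier_matD[OF N(2)]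
    unfolding invertible_mat_def inverts_mat_def square_mat.simps by metis
  have "?z = N * ?M *\<^sub>v ?z" using z by (simp add: N(4))
  also have "\<dots> = N *\<^sub>v (?M *\<^sub>v ?z)" by (rule assoc_mult_mat_vec[OF N(2) M z])
  also have "\<dots> = mat_inv ?M *\<^sub>v (lamL \<cdot>\<^sub>v s)"
    unfolding normal by (simp add: mat_inv_def N(1))
  finally have z_eq: "?z = mat_inv ?M *\<^sub>v (lamL \<cdot>\<^sub>v s)" .
  \<comment> \<open>Off \<open>E\<close> the correction vanishes by its constraint and the Lasso
    solution by optimality, hence so does their sum.\<close>
  have "\<forall>j<p. j \<notin> E \<longrightarrow> \<beta>L $ j = 0"
    using is_lasso_zero_outside_equicorrelation_set[OF X y lam assms(6)] by (simp add: assms(7))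
  then have "subvec \<beta>L (- E) = 0\<^sub>v (p - card E)"
    using subvec_Compl_eq_zero_iff[OF L E] by simp
  then have "subvec \<beta>A (- E) = 0\<^sub>v (p - card E)"
    using dE by (simp add: assms(11) subvec_add[OF L d])
  moreover have "subvec \<beta>A E = subvec \<beta>L E + mat_inv ?M *\<^sub>v (lamL \<cdot>\<^sub>v s)"
    unfolding assms(11) subvec_add[OF L d] by (rule arg_cong[OF z_eq])
  ultimately show ?thesis using normal inv z_eq dE by blast
qed

end
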